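(* Let $0<k<n$ be integers, let $\mathbf{i}=(1\le i_1<i_2<\cdots<i_k\le n)$ be a sequence of integers, and let $\lambda=(\lambda_1\ge\cdots\ge\lambda_k\ge0)$ be the corresponding Young diagram with at most $k$ rows and at most $n-k$ columns, given by $\lambda_{k+1-p}=i_p-p$ for $1\le p\le k$. Let $\varphi:\mathbb{Z}[U]\to Q_n$ be the ring homomorphism with $\varphi(z_{ij})=H_{i-j}^{(j)}$ for $1\le j<i\le n$. Then $$\varphi(\mathsf{P}_{\mathbf{i}})=S_\lambda$$ in $Q_n$, where $\mathsf{P}_{\mathbf{i}}=\det(z_{i_a\,b})_{1\le a,b\le k}$ and $S_\lambda$ is the $\mathbf{q}$-quantization of the Schur polynomial $s_\lambda(x_1,\ldots,x_k)$.
   Context: Fix a positive integer $n$. Let $R_n=\mathbb{Z}[x_1,\ldots,x_n,q_{ij}\mid 1\le i<j\le n]$. For $0\le j\le n$ let $M_j$ be the $j\times j$ matrix with diagonal entries $x_1,\ldots,x_j$, with $(a,b)$ entry $q_{ab}$ for $a<b$, with entries $-1$ in positions $(a+1,a)$, and $0$ elsewhere. Define $E_i^{(j)}\in R_n$ by $\det(tI_j-M_j)=\sum_{i=0}^{j}(-1)^iE_i^{(j)}t^{j-i}$, with $E_0^{(j)}=1$ and $E_i^{(j)}=0$ unless $0\le i\le j$. Put $Q_n=R_n/(E_1^{(n)},\ldots,E_n^{(n)})$; an element of $R_n$ and its image in $Q_n$ are denoted by the same symbol. $\mathbf{q}$-quantization: let $e_i^{(j)}=e_i(x_1,\ldots,x_j)$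 be the elementary symmetric polynomial ($e_0^{(j)}=1$, $e_i^{(j)}=0$ unless $0\le i\le j$). The standard elementary monomials $e_{i_1,\ldots,i_m}=e_{i_1}^{(1)}\cdots e_{i_m}^{(m)}$ ($0\le i_k\le k$; sequences differing by trailing zeros are identified) form a $\mathbb{Z}$-basis of $\mathbb{Z}[x_1,x_2,\ldots]$. If $f=\sum c_{i_1,\ldots,i_m}e_{i_1,\ldots,i_m}$, its $\mathbf{q}$-quantization is $F=\sum c_{i_1,\ldots,i_m}E_{i_1}^{(1)}\cdots E_{i_m}^{(m)}$ (it lies in $R_n$ when only indices $m\le n$ occur, which is the case here). $H_i^{(j)}$ is the $\mathbf{q}$-quantization of the complete symmetric polynomial $h_i^{(j)}=h_i(x_1,\ldots,x_j)$. The Schur polynomial of $\lambda=(\lambda_1\ge\cdots\ge\lambda_k\ge0)$ is $s_\lambda(x_1,\ldots,x_k)=\det(x_b^{\lambda_a+k-a})_{1\le a,b\le k}/\det(x_b^{k-a})_{1\le a,b\le k}$. $\mathbb{Z}[U]=\mathbb{Z}[z_{ij}\mid 1\le j<i\le n]$; $z=(z_{ij})$ is the $n\times n$ lower unipotent matrix with $z_{ii}=1$ and $z_{ij}=0$ for $i<j$. *)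

theory Defs
  imports
    "HOL-Library.Poly_Mapping"
    "HOL-Library.Multiset"
    "HOL-Algebra.QuotRing"
    "Jordan_Normal_Form.Char_Poly"
begin

text \<open>
  Polynomials over the integers in variables of an arbitrary type: finitely supported maps from
  exponent vectors to coefficients, with the convolution product of \<^theory>\<open>HOL-Library.Poly_Mapping\<close>.
\<close>

type_synonym 'v int_mpoly = "('v \<Rightarrow>\<^sub>0 nat) \<Rightarrow>\<^sub>0 int"

definition Var :: "'v \<Rightarrow> 'v int_mpoly" where
  "Var v = Poly_Mapping.single (Poly_Mapping.single v 1) 1"

definition vars :: "'v int_mpoly \<Rightarrow> 'v set" where
  "vars p = (\<Union>m \<in> Poly_Mapping.keys p. Poly_Mapping.keys m)"

definition mpoly_ring :: "'v set \<Rightarrow> 'v int_mpoly ring" where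
  "mpoly_ring V = \<lparr>carrier = {p. vars p \<subseteq> V}, monoid.mult = (*), one = 1, zero = 0, add = (+)\<rparr>"

lemma vars_add: "vars (p + q) \<subseteq> vars p \<union> vars q"
  unfolding vars_def using keys_add[of p q] by blast

lemma vars_mult: "vars (p * q) \<subseteq> vars p \<union> vars q"
  unfolding vars_def using keys_mult[of p q] keys_add by fastforce

lemma vars_uminus: "vars (- p) = vars p"
  by (simp add: vars_def)

lemma cring_mpoly_ring: "cring (mpoly_ring V)"
proof (intro cringI abelian_groupI comm_monoidI)
  fix p assume p: "p \<in> carrier (mpoly_ring V)"
  show "\<exists>q\<in>carrier (mpoly_ring V). q \<oplus>\<^bsub>mpoly_ring V\<^esub> p = \<zero>\<^bsub>mpoly_ring V\<^esub>"
    using p by (intro bexI[of _ "- p"]) (auto simp: mpoly_ring_def vars_uminus)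
next
  fix p q assume "p \<in> carrier (mpoly_ring V)" "q \<in> carrier (mpoly_ring V)"
  then show "p \<oplus>\<^bsub>mpoly_ring V\<^esub> q \<in> carrier (mpoly_ring V)"
    using vars_add[of p q] by (auto simp: mpoly_ring_def)
next
  fix p q assume "p \<in> carrier (mpoly_ring V)" "q \<in> carrier (mpoly_ring V)"
  then show "p \<otimes>\<^bsub>mpoly_ring V\<^esub> q \<in> carrier (mpoly_ring V)"
    using vars_mult[of p q] by (auto simp: mpoly_ring_def)
qed (auto simp: mpoly_ring_def vars_def algebra_simps)

text \<open>
  The variables \<open>x\<^sub>i\<close> and \<open>q\<^sub>i\<^sub>j\<close>. Only \<open>X i\<close> with \<open>i \<ge> 1\<close> and \<open>Q i j\<close> with \<open>1 \<le> i < j\<close> are ever used.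
  All polynomials in them live in one type; \<open>R_ring n\<close> carves out the polynomials in the variables
  with indices at most \<open>n\<close>.
\<close>

datatype xq_var = X nat | Q nat nat

abbreviation x_var :: "nat \<Rightarrow> xq_var int_mpoly" where "x_var i \<equiv> Var (X i)"
abbreviation q_var :: "nat \<Rightarrow> nat \<Rightarrow> xq_var int_mpoly" where "q_var i j \<equiv> Var (Q i j)"

definition R_ring :: "nat \<Rightarrow> xq_var int_mpoly ring" where
  "R_ring n = mpoly_ring ({X i | i. 1 \<le> i \<and> i \<le> n} \<union> {Q i j | i j. 1 \<le> i \<and> i < j \<and> j \<le> n})"

text \<open>Matrix indices of \<^const>\<open>mat\<close> start at 0, the indices of the variables at 1.\<close>

definition M_mat :: "nat \<Rightarrow> xq_var int_mpoly mat" where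
  "M_mat j = mat j j (\<lambda>(a, b).
     if a = b then x_var (Suc a)
     else if a < b then q_var (Suc a) (Suc b)
     else if a = Suc b then - 1
     else 0)"

text \<open>\<^term>\<open>E_poly i j\<close> is \<open>E\<^sub>i\<close> with upper index \<open>j\<close>; likewise for \<open>elem_sym\<close>, \<open>complete_sym\<close> and
  \<open>H_poly\<close> below.\<close>

definition E_poly :: "nat \<Rightarrow> nat \<Rightarrow> xq_var int_mpoly" where
  "E_poly i j = (if i \<le> j then (- 1) ^ i * poly.coeff (char_poly (M_mat j)) (j - i) else 0)"

definition E_ideal :: "nat \<Rightarrow> xq_var int_mpoly set" where
  "E_ideal n = Idl\<^bsub>R_ring n\<^esub> {E_poly i n | i. 1 \<le> i \<and> i \<le> n}"

definition Q_ring :: "nat \<Rightarrow> xq_var int_mpoly set ring" where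
  "Q_ring n = R_ring n Quot E_ideal n"

definition to_Q :: "nat \<Rightarrow> xq_var int_mpoly \<Rightarrow> xq_var int_mpoly set" where
  "to_Q n f = E_ideal n +>\<^bsub>R_ring n\<^esub> f"

definition elem_sym :: "nat \<Rightarrow> nat \<Rightarrow> xq_var int_mpoly" where
  "elem_sym i j = (\<Sum>A | A \<subseteq> {1..j} \<and> card A = i. \<Prod>a\<in>A. x_var a)"

definition complete_sym :: "nat \<Rightarrow> nat \<Rightarrow> xq_var int_mpoly" where
  "complete_sym i j = (\<Sum>A \<in> multisets_of_size {1..j} i. \<Prod>a\<in>#A. x_var a)"

text \<open>
  Index sequences \<open>(i\<^sub>1, \<dots>, i\<^sub>m)\<close> with \<open>0 \<le> i\<^sub>k \<le> k\<close>, up to trailing zeros, are the finitely supported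
  maps \<open>I\<close> with \<open>I k \<le> k\<close>; the position \<open>k = 0\<close> is unused since \<open>I 0 \<le> 0\<close>.
\<close>

definition std_indices :: "(nat \<Rightarrow>\<^sub>0 nat) set" where
  "std_indices = {I. \<forall>k. Poly_Mapping.lookup I k \<le> k}"

definition std_elem_monomial :: "(nat \<Rightarrow>\<^sub>0 nat) \<Rightarrow> xq_var int_mpoly" where
  "std_elem_monomial I = (\<Prod>k\<in>Poly_Mapping.keys I. elem_sym (Poly_Mapping.lookup I k) k)"

definition quantum_std_elem_monomial :: "(nat \<Rightarrow>\<^sub>0 nat) \<Rightarrow> xq_var int_mpoly" where
  "quantum_std_elem_monomial I = (\<Prod>k\<in>Poly_Mapping.keys I. E_poly (Poly_Mapping.lookup I k) k)"

text \<open>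
  The coefficients of \<open>f\<close> in the \<open>\<int>\<close>-basis of standard elementary monomials; well defined for \<open>f\<close> a
  polynomial in \<open>x\<^sub>1, x\<^sub>2, \<dots>\<close> without the \<open>q\<^sub>i\<^sub>j\<close>.
\<close>

definition std_elem_coeffs :: "xq_var int_mpoly \<Rightarrow> ((nat \<Rightarrow>\<^sub>0 nat) \<Rightarrow>\<^sub>0 int)" where
  "std_elem_coeffs f = (THE c. Poly_Mapping.keys c \<subseteq> std_indices \<and>
     f = (\<Sum>I\<in>Poly_Mapping.keys c. of_int (Poly_Mapping.lookup c I) * std_elem_monomial I))"

definition quantization :: "xq_var int_mpoly \<Rightarrow> xq_var int_mpoly" where
  "quantization f = (\<Sum>I\<in>Poly_Mapping.keys (std_elem_coeffs f).
     of_int (Poly_Mapping.lookup (std_elem_coeffs f) I) * quantum_std_elem_monomial I)"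

definition H_poly :: "nat \<Rightarrow> nat \<Rightarrow> xq_var int_mpoly" where
  "H_poly i j = quantization (complete_sym i j)"

text \<open>
  The parts of a partition with at most \<open>k\<close> rows are \<open>\<lambda> 1, \<dots>, \<lambda> k\<close>. The Schur polynomial is the
  quotient of the two alternants, taken in the polynomial ring (an integral domain, where the
  division is exact).
\<close>

definition alternant :: "nat \<Rightarrow> (nat \<Rightarrow> nat) \<Rightarrow> xq_var int_mpoly" where
  "alternant k \<mu> = det (mat k k (\<lambda>(a, b). x_var (Suc b) ^ (\<mu> (Suc a) + (k - Suc a))))"

definition schur :: "nat \<Rightarrow> (nat \<Rightarrow> nat) \<Rightarrow> xq_var int_mpoly" where
  "schur k \<mu> = (THE s. s * alternant k (\<lambda>_. 0) = alternant k \<mu>)"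

definition S_poly :: "nat \<Rightarrow> (nat \<Rightarrow> nat) \<Rightarrow> xq_var int_mpoly" where
  "S_poly k \<mu> = quantization (schur k \<mu>)"

text \<open>\<open>\<int>[U]\<close>: the variable \<open>z\<^sub>i\<^sub>j\<close> is \<^term>\<open>Var (i, j)\<close>; \<open>z_entry\<close> is the generic lower unipotent matrix.\<close>

definition ZU_ring :: "nat \<Rightarrow> (nat \<times> nat) int_mpoly ring" where
  "ZU_ring n = mpoly_ring {(i, j). 1 \<le> j \<and> j < i \<and> i \<le> n}"

definition z_entry :: "nat \<Rightarrow> nat \<Rightarrow> (nat \<times> nat) int_mpoly" where
  "z_entry i j = (if i = j then 1 else if j < i then Var (i, j) else 0)"

definition flag_minor :: "nat \<Rightarrow> (nat \<Rightarrow> nat) \<Rightarrow> (nat \<times> nat) int_mpoly" where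
  "flag_minor k \<iota> = det (mat k k (\<lambda>(a, b). z_entry (\<iota> (Suc a)) (Suc b)))"

end

theory Submission
  imports Defs "HOL-Computational_Algebra.Formal_Power_Series" "HOL-Library.Nat_Bijection"
begin

text \<open>
  The generating functions of the \<open>e\<^sub>i\<close> and \<open>h\<^sub>i\<close> show that the unitriangular matrices
  \<open>g = ((-1)\<^sup>r\<^sup>-\<^sup>c e\<^sub>r\<^sub>-\<^sub>c(x\<^sub>1, \<dots>, x\<^sub>r\<^sub>-\<^sub>1))\<close> and \<open>h = (h\<^sub>r\<^sub>-\<^sub>c(x\<^sub>1, \<dots>, x\<^sub>c))\<close> are inverse to each other. By
  Jacobi's formula every minor of \<open>h\<close> is a determinant whose \<open>r\<close>-th row is made of entries of the
  \<open>r\<close>-th row of \<open>g\<close> and constants. Since each row involves a single level of elementary polynomials,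
  the Leibniz expansion is a combination of standard elementary monomials, so its quantization is
  the same determinant with \<open>E\<close> in place of \<open>e\<close>. For single entries this says that the quantization
  \<open>H\<close> of \<open>h\<close> is inverse to the quantization \<open>G\<close> of \<open>g\<close>; hence by Jacobi's formula again, quantization
  carries minors of \<open>h\<close> to minors of \<open>H\<close>. Finally \<open>s\<^sub>\<lambda>\<close> is the minor of \<open>h\<close> with rows
  \<open>i\<^sub>1, \<dots>, i\<^sub>k\<close> and columns \<open>1, \<dots>, k\<close>, by Newton interpolation of the powers \<open>x\<^sup>m\<close> at \<open>x\<^sub>1, x\<^sub>2, \<dots>\<close>.
\<close>

text \<open>\<^typ>\<open>xq_var int_mpoly\<close> is recognised as an \<^class>\<open>idom\<close> only over linearly ordered variables.\<close>

instantiation xq_var :: linorder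
begin

fun xq_var_code :: "xq_var \<Rightarrow> nat" where
  "xq_var_code (X i) = sum_encode (Inl i)"
| "xq_var_code (Q i j) = sum_encode (Inr (prod_encode (i, j)))"

definition less_eq_xq_var :: "xq_var \<Rightarrow> xq_var \<Rightarrow> bool" where
  "less_eq_xq_var a b \<longleftrightarrow> xq_var_code a \<le> xq_var_code b"

definition less_xq_var :: "xq_var \<Rightarrow> xq_var \<Rightarrow> bool" where
  "less_xq_var a b \<longleftrightarrow> xq_var_code a < xq_var_code b"

instance
proof
  fix a b :: xq_var
  show "a = b" if "a \<le> b" "b \<le> a"
  proof -
    have "xq_var_code a = xq_var_code b"
      using that by (simp add: less_eq_xq_var_def)
    then show ?thesis
      by (cases a; cases b) (auto simp: sum_encode_eq prod_encode_eq)
  qed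
qed (auto simp: less_eq_xq_var_def less_xq_var_def)

end

section \<open>Elementary and complete symmetric polynomials\<close>

text \<open>General rings and index sets, so that the same recursions serve the polynomials
  \<open>x_var\<close>, integer evaluations, and sets such as {1..k+1} with one point
  removed.\<close>

definition esym :: "('b \<Rightarrow> 'a::comm_ring_1) \<Rightarrow> nat \<Rightarrow> 'b set \<Rightarrow> 'a" where
  "esym x i A = (\<Sum>B | B \<subseteq> A \<and> card B = i. \<Prod>a\<in>B. x a)"

definition hsym :: "('b \<Rightarrow> 'a::comm_ring_1) \<Rightarrow> nat \<Rightarrow> 'b set \<Rightarrow> 'a" where
  "hsym x i A = (\<Sum>M \<in> multisets_of_size A i. \<Prod>a\<in>#M. x a)"

lemma elem_sym_eq_esym: "elem_sym i j = esym x_var i {1..j}"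
  by (simp add: elem_sym_def esym_def)

lemma complete_sym_eq_hsym: "complete_sym i j = hsym x_var i {1..j}"
  by (simp add: complete_sym_def hsym_def)

lemma esym_0 [simp]: "finite A \<Longrightarrow> esym x 0 A = 1"
proof -
  assume "finite A"
  then have "{B. B \<subseteq> A \<and> card B = 0} = {{}}"
    by (auto simp: card_eq_0_iff dest: finite_subset)
  then show ?thesis by (simp add: esym_def)
qed

lemma esym_eq_0: "finite A \<Longrightarrow> card A < i \<Longrightarrow> esym x i A = 0"
proof -
  assume "finite A" "card A < i"
  then have "{B. B \<subseteq> A \<and> card B = i} = {}"
    using card_mono leD by blast
  then show ?thesis unfolding esym_def by (simp only:) simp
qed

lemma esym_insert:
  assumes "finite A" "a \<notin> A"
  shows "esym x (Suc i) (insert a A) = esym x (Suc i) A + x a * esym x i A"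
proof -
  let ?S = "{B. B \<subseteq> A \<and> card B = Suc i}" and ?T = "{B. B \<subseteq> A \<and> card B = i}"
  have eq: "{B. B \<subseteq> insert a A \<and> card B = Suc i} = ?S \<union> insert a ` ?T" (is "?L = ?R")
  proof (intro subset_antisym subsetI)
    fix B assume B: "B \<in> ?L"
    then have finB: "finite B" using assms finite_subset by auto
    show "B \<in> ?R"
    proof (cases "a \<in> B")
      case True
      with B finB have "B = insert a (B - {a})" "B - {a} \<in> ?T" by auto
      then show ?thesis by blast
    qed (use B in auto)
  next
    fix B assume "B \<in> ?R"
    then show "B \<in> ?L"
    proof
      assume "B \<in> insert a ` ?T"
      then obtain C where C: "B = insert a C" "C \<subseteq> A" "card C = i" by auto
      with assms have "a \<notin> C" "finite C" by (auto intro: finite_subset)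
      with C show ?thesis by auto
    qed auto
  qed
  have "(\<Sum>B\<in>insert a ` ?T. prod x B) = (\<Sum>B\<in>?T. prod x (insert a B))"
    using assms by (subst sum.reindex) (auto simp: inj_on_def)
  also have "\<dots> = (\<Sum>B\<in>?T. x a * prod x B)"
  proof (intro sum.cong refl)
    fix B assume "B \<in> ?T"
    then have "finite B" "a \<notin> B" using assms by (auto intro: finite_subset)
    then show "prod x (insert a B) = x a * prod x B" by simp
  qed
  finally have "(\<Sum>B\<in>insert a ` ?T. prod x B) = x a * esym x i A"
    by (simp add: esym_def sum_distrib_left)
  moreover have "?S \<inter> insert a ` ?T = {}" using assms by auto
  ultimately show ?thesis
    unfolding esym_def eq using assms by (subst sum.union_disjoint) auto
qed

text \<open>If \<open>g\<close> permutes \<open>A\<close> this is symmetry; a transposition that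
  moves a point out of \<open>A\<close> changes which variable is omitted.\<close>

lemma esym_image:
  assumes "inj_on g A"
  shows "esym (x \<circ> g) i A = esym x i (g ` A)"
proof -
  have inj: "inj_on g B" if "B \<subseteq> A" for B
    using assms that inj_on_subset by blast
  have "bij_betw ((`) g) {B. B \<subseteq> A \<and> card B = i} {B. B \<subseteq> g ` A \<and> card B = i}"
    unfolding bij_betw_def
  proof (intro conjI subset_antisym subsetI)
    show "inj_on ((`) g) {B. B \<subseteq> A \<and> card B = i}"
      using assms by (auto simp: inj_on_def inj_on_image_eq_iff[OF assms])
  next
    fix B assume "B \<in> {B. B \<subseteq> g ` A \<and> card B = i}"
    then obtain C where "C \<subseteq> A" "B = g ` C" "card B = i"
      by (auto simp: subset_image_iff)
    then show "B \<in> (`) g ` {B. B \<subseteq> A \<and> card B = i}"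
      using inj by (auto simp: card_image)
  qed (use inj in \<open>auto simp: card_image\<close>)
  have "esym (x \<circ> g) i A = (\<Sum>B | B \<subseteq> A \<and> card B = i. prod x (g ` B))"
    unfolding esym_def using inj by (intro sum.cong refl) (simp add: prod.reindex)
  also have "\<dots> = esym x i (g ` A)"
    unfolding esym_def by (rule sum.reindex_bij_betw) fact
  finally show ?thesis .
qed

lemma hsym_0 [simp]: "hsym x 0 A = 1"
  by (simp add: hsym_def)

lemma hsym_empty: "0 < i \<Longrightarrow> hsym x i {} = 0"
  by (simp add: hsym_def)

text \<open>Multisets may repeat \<open>a\<close>, so removing one copy leaves a multiset still over
  \<open>insert a A\<close>, in contrast to \<open>esym_insert\<close>.\<close>

lemma hsym_insert:
  assumes "finite A" "a \<notin> A"
  shows "hsym x (Suc i) (insert a A) = hsym x (Suc i) A + x a * hsym x i (insert a A)"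
proof -
  let ?S = "multisets_of_size A (Suc i)" and ?T = "multisets_of_size (insert a A) i"
  have eq: "multisets_of_size (insert a A) (Suc i) = ?S \<union> add_mset a ` ?T" (is "?L = ?R")
  proof (intro subset_antisym subsetI)
    fix M assume M: "M \<in> ?L"
    show "M \<in> ?R"
    proof (cases "a \<in># M")
      case True
      then obtain M' where "M = add_mset a M'" by (metis mset_add)
      with M show ?thesis by (auto simp: multisets_of_size_def)
    qed (use M in \<open>auto simp: multisets_of_size_def\<close>)
  qed (auto simp: multisets_of_size_def)
  have "?S \<inter> add_mset a ` ?T = {}" using assms by (auto simp: multisets_of_size_def)
  moreover have "finite ?S" "finite ?T"
    using assms by (auto intro: finite_multisets_of_size)
  moreover have "(\<Sum>M\<in>add_mset a ` ?T. \<Prod>b\<in>#M. x b) = x a * hsym x i (insert a A)"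
    by (subst sum.reindex) (auto simp: hsym_def sum_distrib_left inj_on_def)
  ultimately show ?thesis
    unfolding hsym_def[of x "Suc i"] eq by (subst sum.union_disjoint) auto
qed

section \<open>Generating functions\<close>

definition esym_fps :: "('b \<Rightarrow> 'a::comm_ring_1) \<Rightarrow> 'b set \<Rightarrow> 'a fps" where
  "esym_fps x A = (\<Prod>a\<in>A. 1 - fps_const (x a) * fps_X)"

lemma esym_fps_nth: "finite A \<Longrightarrow> fps_nth (esym_fps x A) i = (- 1) ^ i * esym x i A"
proof (induction A arbitrary: i rule: finite_induct)
  case empty
  then show ?case by (cases i) (auto simp: esym_fps_def esym_eq_0)
next
  case (insert a A)
  have "esym_fps x (insert a A) = esym_fps x A - fps_const (x a) * (fps_X * esym_fps x A)"
    using insert.hyps by (simp add: esym_fps_def algebra_simps)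
  then show ?case
    unfolding \<open>esym_fps x (insert a A) = _\<close>
    using insert by (cases i) (simp_all add: esym_insert algebra_simps)
qed

text \<open>By \<open>hsym_insert\<close>, multiplying the series for \<open>insert a A\<close> by
  the factor of \<open>a\<close> leaves the series for \<open>A\<close>; the factors cancel one at a
  time.\<close>

lemma hsym_fps: "finite A \<Longrightarrow> Abs_fps (\<lambda>i. hsym x i A) * esym_fps x A = 1"
proof (induction A rule: finite_induct)
  case empty
  have "Abs_fps (\<lambda>i. hsym x i {}) = (1 :: 'b fps)"
    by (intro fps_ext) (simp add: hsym_empty)
  then show ?case by (simp add: esym_fps_def)
next
  case (insert a A)
  have "Abs_fps (\<lambda>i. hsym x i (insert a A)) * (1 - fps_const (x a) * fps_X) = Abs_fps (\<lambda>i. hsym x i A)"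
  proof (rule fps_ext)
    fix i
    have "Abs_fps (\<lambda>i. hsym x i (insert a A)) * (1 - fps_const (x a) * fps_X)
        = Abs_fps (\<lambda>i. hsym x i (insert a A)) - fps_const (x a) * (fps_X * Abs_fps (\<lambda>i. hsym x i (insert a A)))"
      by (simp add: algebra_simps)
    then show "fps_nth (Abs_fps (\<lambda>i. hsym x i (insert a A)) * (1 - fps_const (x a) * fps_X)) i
        = fps_nth (Abs_fps (\<lambda>i. hsym x i A)) i"
      using insert by (cases i) (auto simp: hsym_insert)
  qed
  with insert show ?case by (simp add: esym_fps_def mult.assoc[symmetric])
qed

text \<open>The factors of \<open>esym_fps x B\<close> indexed by \<open>A\<close> cancel against
  the series of complete polynomials; only those over \<open>B - A\<close> survive.\<close>

lemma alternating_esym_hsym: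
  assumes "finite B" "A \<subseteq> B"
  shows "(\<Sum>i=0..m. (- 1) ^ i * esym x i B * hsym x (m - i) A) = (- 1) ^ m * esym x m (B - A)"
proof -
  have fin: "finite A" using assms finite_subset by blast
  have "esym_fps x B = esym_fps x (B - A) * esym_fps x A"
    unfolding esym_fps_def using assms by (intro prod.subset_diff)
  then have "esym_fps x B * Abs_fps (\<lambda>i. hsym x i A) = esym_fps x (B - A)"
    using hsym_fps[OF fin, of x] by (simp add: mult.assoc mult.commute[of "esym_fps x A"])
  then have "fps_nth (esym_fps x B * Abs_fps (\<lambda>i. hsym x i A)) m = fps_nth (esym_fps x (B - A)) m"
    by simp
  then show ?thesis using assms by (simp add: fps_mult_nth esym_fps_nth)
qed

text \<open>Unrolling \<open>esym_insert\<close> turns the omission of \<open>a\<close> into a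
  polynomial in \<open>x a\<close> whose coefficients do not depend on which \<open>a\<close> is
  omitted.\<close>

lemma esym_remove:
  assumes "finite A" "a \<in> A"
  shows "esym x i (A - {a}) = (\<Sum>l\<le>i. (- x a) ^ l * esym x (i - l) A)"
proof (induction i)
  case 0
  then show ?case using assms by simp
next
  case (Suc i)
  have "esym x (Suc i) A = esym x (Suc i) (A - {a}) + x a * esym x i (A - {a})"
    using esym_insert[of "A - {a}" a x i] assms by (simp add: insert_absorb)
  then have "esym x (Suc i) (A - {a}) = esym x (Suc i) A + (- x a) * (\<Sum>l\<le>i. (- x a) ^ l * esym x (i - l) A)"
    using Suc by (simp add: algebra_simps)
  also have "\<dots> = (\<Sum>l\<le>Suc i. (- x a) ^ l * esym x (Suc i - l) A)"
    by (subst sum.atMost_Suc_shift) (simp add: sum_distrib_left mult.assoc)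
  finally show ?case .
qed

section \<open>Independence of products of elementary polynomials\<close>

text \<open>As a function of \<open>t = x a\<close>, the sum in the hypothesis is a polynomial of degree at most \<open>k\<close> with
  triangular coefficients in the \<open>f i\<close>, and it has \<open>k + 1\<close> roots.\<close>

lemma esym_omit_independent:
  fixes x :: "'b \<Rightarrow> 'a::idom"
  assumes "finite A" "card A = Suc k" "inj_on x A"
    and zero: "\<And>a. a \<in> A \<Longrightarrow> (\<Sum>i\<le>k. f i * esym x i (A - {a})) = 0"
    and "i \<le> k"
  shows "f i = 0"
proof -
  define P where "P = (\<Sum>i\<le>k. \<Sum>l\<le>i. monom (f i * (- 1) ^ l * esym x (i - l) A) l)"
  have "poly P (x a) = 0" if "a \<in> A" for a
  proof -
    have "poly P (x a) = (\<Sum>i\<le>k. f i * esym x i (A - {a}))"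
      unfolding P_def using esym_remove[OF assms(1) that, of x]
      by (simp add: poly_sum poly_monom sum_distrib_left power_minus[of "x a"] algebra_simps)
    then show ?thesis using zero that by simp
  qed
  then have sub: "x ` A \<subseteq> {t. poly P t = 0}" by auto
  have deg: "degree P \<le> k"
    unfolding P_def
    by (intro degree_sum_le) (auto intro: order.trans[OF degree_monom_le])
  have "P = 0"
  proof (rule ccontr)
    assume "P \<noteq> 0"
    then have "card (x ` A) \<le> degree P"
      using card_mono[OF poly_roots_finite sub] card_poly_roots_bound[of P] by force
    with deg assms show False by (simp add: card_image)
  qed
  have c: "coeff P l = (\<Sum>i\<le>k. if l \<le> i then f i * (- 1) ^ l * esym x (i - l) A else 0)" for l
    unfolding P_def by (simp add: coeff_sum if_distrib sum.If_cases) 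
  show ?thesis using assms(5)
  \<comment> \<open>Descending in \<open>i\<close>: the coefficient of degree \<open>i\<close> in
    \<open>P\<close> involves only \<open>f j\<close> with \<open>j \<ge> i\<close>, and
    \<open>f i\<close> occurs with factor \<open>(- 1) ^ i\<close> because
    \<open>esym x 0 A = 1\<close>.\<close>
  proof (induction "k - i" arbitrary: i rule: less_induct)
    case less
    have "0 = (\<Sum>j\<le>k. if i \<le> j then f j * (- 1) ^ i * esym x (j - i) A else 0)"
      using c[of i] \<open>P = 0\<close> by simp
    also have "\<dots> = (\<Sum>j\<le>k. if j = i then f i * (- 1) ^ i else 0)"
    proof (intro sum.cong refl)
      fix j assume "j \<in> {..k}"
      then show "(if i \<le> j then f j * (- 1) ^ i * esym x (j - i) A else 0) = (if j = i then f i * (- 1) ^ i else 0)"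
        using less.hyps[of j] less.prems assms(1) by (cases "i < j") auto
    qed
    also have "\<dots> = f i * (- 1) ^ i" using less.prems by simp
    finally show ?case by simp
  qed
qed

text \<open>Induction on the lowest level \<open>k\<close>: the coefficient \<open>h i\<close> of \<open>esym x i {1..k}\<close> is symmetric in
  \<open>x 1, \<dots>, x (k + 1)\<close>, so exchanging \<open>x j\<close> and \<open>x (k + 1)\<close> for all \<open>j\<close> yields the hypothesis of
  \<open>esym_omit_independent\<close>.\<close>

lemma esym_products_independent:
  fixes c :: "'b \<Rightarrow> int"
  assumes "finite S"
    and "\<And>b r. b \<in> S \<Longrightarrow> r \<in> {k..<N} \<Longrightarrow> I b r \<le> r"
    and "\<And>b b'. b \<in> S \<Longrightarrow> b' \<in> S \<Longrightarrow> (\<And>r. r \<in> {k..<N} \<Longrightarrow> I b r = I b' r) \<Longrightarrow> b = b'"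
    and "\<And>x :: nat \<Rightarrow> int. inj x \<Longrightarrow> (\<Sum>b\<in>S. c b * (\<Prod>r=k..<N. esym x (I b r) {1..r})) = 0"
    and "b \<in> S"
  shows "c b = 0"
  using assms
proof (induction "N - k" arbitrary: k S b)
  case 0
  then have e: "{k..<N} = {}" by simp
  have "b' = b" if "b' \<in> S" for b'
    using "0.prems"(3)[OF that "0.prems"(5)] e by simp
  then have "S = {b}" using "0.prems"(5) by blast
  \<comment> \<open>No level remains, so all products are 1; the inclusion \<open>int\<close> serves
    as an injective point.\<close>
  then show ?case using "0.prems"(4)[of int] e by simp
next
  case (Suc d)
  then have kN: "k < N" "d = N - Suc k" by auto
  \<comment> \<open>\<open>h i\<close> collects the terms with index \<open>i\<close> at level
    \<open>k\<close>; only levels above \<open>k\<close> remain in it.\<close>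
  define h where "h i x = (\<Sum>b\<in>{b\<in>S. I b k = i}. c b * (\<Prod>r=Suc k..<N. esym x (I b r) {1..r}))"
    for i and x :: "nat \<Rightarrow> int"
  have split: "(\<Sum>b\<in>S. c b * (\<Prod>r=k..<N. esym x (I b r) {1..r})) = (\<Sum>i\<le>k. h i x * esym x i {1..k})"
    for x :: "nat \<Rightarrow> int"
  proof -
    have "(\<Sum>b\<in>S. c b * (\<Prod>r=k..<N. esym x (I b r) {1..r}))
        = (\<Sum>i\<le>k. \<Sum>b\<in>{b\<in>S. I b k = i}. c b * (\<Prod>r=k..<N. esym x (I b r) {1..r}))"
      using Suc.prems(1,2) kN by (subst sum.group) auto
    also have "\<dots> = (\<Sum>i\<le>k. h i x * esym x i {1..k})"
      unfolding h_def sum_distrib_right using kN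
      by (intro sum.cong refl) (simp add: prod.atLeast_Suc_lessThan)
    finally show ?thesis .
  qed
  have h_swap: "h i (x \<circ> transpose j (Suc k)) = h i x" if "j \<in> {1..Suc k}" for i j and x :: "nat \<Rightarrow> int"
    unfolding h_def
  proof (intro sum.cong arg_cong2[of _ _ _ _ "(*)"] prod.cong refl)
    fix b r assume "r \<in> {Suc k..<N}"
    then have "transpose j (Suc k) ` {1..r} = {1..r}"
      using that by (intro transpose_image_eq) auto
    then show "esym (x \<circ> transpose j (Suc k)) (I b r) {1..r} = esym x (I b r) {1..r}"
      using esym_image[of "transpose j (Suc k)" "{1..r}" x] by simp
  qed
  have h0: "h i x = 0" if "inj x" "i \<le> k" for i x
  proof (rule esym_omit_independent[of "{1..Suc k}" k x])
    fix j assume j: "j \<in> {1..Suc k}"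
    let ?y = "x \<circ> transpose j (Suc k)"
    have "inj ?y" using that by (intro inj_compose) auto
    then have "(\<Sum>i\<le>k. h i ?y * esym ?y i {1..k}) = 0"
      using Suc.prems(4) split by simp
    moreover have "transpose j (Suc k) ` {1..k} = {1..Suc k} - {j}"
    proof -
      have "{1..k} = {1..Suc k} - {Suc k}" by auto
      then have "transpose j (Suc k) ` {1..k}
          = transpose j (Suc k) ` {1..Suc k} - transpose j (Suc k) ` {Suc k}"
        by (metis image_set_diff inj_transpose)
      also have "\<dots> = {1..Suc k} - {j}"
        using j by (subst transpose_image_eq) auto
      finally show ?thesis .
    qed
    ultimately show "(\<Sum>i\<le>k. h i x * esym x i ({1..Suc k} - {j})) = 0"
      using j by (simp add: h_swap esym_image)
  qed (use that in \<open>auto simp: inj_on_def\<close>)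
  show ?case
  \<comment> \<open>Members of this class agree at level \<open>k\<close>, so distinct ones already
    differ at a higher level.\<close>
  proof (rule Suc.hyps(1)[OF kN(2), of "{b'\<in>S. I b' k = I b k}"])
    show "I b' r \<le> r" if "b' \<in> {b'\<in>S. I b' k = I b k}" "r \<in> {Suc k..<N}" for b' r
      using that Suc.prems(2) by simp
    show "b1 = b2" if "b1 \<in> {b'\<in>S. I b' k = I b k}" "b2 \<in> {b'\<in>S. I b' k = I b k}"
      "\<And>r. r \<in> {Suc k..<N} \<Longrightarrow> I b1 r = I b2 r" for b1 b2
    proof (rule Suc.prems(3))
      fix r assume "r \<in> {k..<N}"
      then show "I b1 r = I b2 r" using that by (cases "r = k") auto
    qed (use that in auto)
    show "(\<Sum>b\<in>{b'\<in>S. I b' k = I b k}. c b * (\<Prod>r=Suc k..<N. esym x (I b r) {1..r})) = 0"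
      if "inj x" for x :: "nat \<Rightarrow> int"
      using h0[OF that, of "I b k"] Suc.prems(2)[OF Suc.prems(5), of k] kN unfolding h_def by simp
  qed (use Suc.prems in auto)
qed

section \<open>Evaluation of polynomials at integer points\<close>

definition eval_mpoly :: "('v \<Rightarrow> int) \<Rightarrow> 'v int_mpoly \<Rightarrow> int" where
  "eval_mpoly x p = (\<Sum>m\<in>Poly_Mapping.keys p.
     Poly_Mapping.lookup p m * (\<Prod>v\<in>Poly_Mapping.keys m. x v ^ Poly_Mapping.lookup m v))"

lemma eval_mpoly_superset:
  assumes "finite S" "Poly_Mapping.keys p \<subseteq> S"
  shows "eval_mpoly x p =
    (\<Sum>m\<in>S. Poly_Mapping.lookup p m * (\<Prod>v\<in>Poly_Mapping.keys m. x v ^ Poly_Mapping.lookup m v))"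
  unfolding eval_mpoly_def using assms
  by (intro sum.mono_neutral_left) (auto simp: in_keys_iff)

lemma eval_mpoly_add: "eval_mpoly x (p + q) = eval_mpoly x p + eval_mpoly x q"
proof -
  let ?S = "Poly_Mapping.keys p \<union> Poly_Mapping.keys q"
  have "finite ?S" "Poly_Mapping.keys (p + q) \<subseteq> ?S" by (auto dest: subsetD[OF keys_add])
  then show ?thesis
    by (simp add: eval_mpoly_superset[of ?S] lookup_add distrib_right sum.distrib)
qed

lemma eval_mpoly_0 [simp]: "eval_mpoly x 0 = 0"
  by (simp add: eval_mpoly_def)

lemma eval_mpoly_diff: "eval_mpoly x (p - q) = eval_mpoly x p - eval_mpoly x q"
  using eval_mpoly_add[of x "p - q" q] by simp

lemma eval_mpoly_1 [simp]: "eval_mpoly x 1 = 1"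
  by (simp add: eval_mpoly_def single_one[symmetric] del: single_one)

lemma eval_mpoly_of_int [simp]: "eval_mpoly x (of_int a) = a"
  using single_of_int[of a, where ?'b = int, symmetric, where ?'a = "'a \<Rightarrow>\<^sub>0 nat"]
  by (simp add: eval_mpoly_def del: single_of_int)

lemma eval_mpoly_Var [simp]: "eval_mpoly x (Var v) = x v"
  by (simp add: eval_mpoly_def Var_def)

lemma eval_mpoly_frag_of_mult:
  "eval_mpoly x (frag_of m * frag_of m') = eval_mpoly x (frag_of m) * eval_mpoly x (frag_of m')"
proof -
  let ?S = "Poly_Mapping.keys m \<union> Poly_Mapping.keys m'"
  have e: "(\<Prod>v\<in>Poly_Mapping.keys l. x v ^ Poly_Mapping.lookup l v) = (\<Prod>v\<in>?S. x v ^ Poly_Mapping.lookup l v)"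
    if "Poly_Mapping.keys l \<subseteq> ?S" for l
    using that by (intro prod.mono_neutral_left) (auto simp: in_keys_iff)
  have "eval_mpoly x (frag_of l) = (\<Prod>v\<in>Poly_Mapping.keys l. x v ^ Poly_Mapping.lookup l v)" for l
    by (simp add: eval_mpoly_def)
  then show ?thesis
    using e[of "m + m'"] e[of m] e[of m'] keys_add[of m m']
    by (simp add: mult_single lookup_add power_add prod.distrib)
qed

text \<open>Polynomials form the free abelian group on exponent vectors, with
  \<open>frag_of m\<close> a monomial; biadditivity reduces the claim to two monomials.\<close>

lemma eval_mpoly_mult: "eval_mpoly x (p * q) = eval_mpoly x p * eval_mpoly x q"
proof (induction p rule: frag_induction[OF subset_UNIV])
  case (2 m)
  show ?case
  proof (induction q rule: frag_induction[OF subset_UNIV])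
    case (2 m')
    show ?case by (rule eval_mpoly_frag_of_mult)
  qed (simp_all add: eval_mpoly_diff algebra_simps)
qed (simp_all add: eval_mpoly_diff algebra_simps)

interpretation eval_mpoly: comm_ring_hom "eval_mpoly x" for x
  by unfold_locales (simp_all add: eval_mpoly_add eval_mpoly_mult)

lemma eval_elem_sym: "eval_mpoly x (elem_sym i j) = esym (\<lambda>a. x (X a)) i {1..j}"
  by (simp add: elem_sym_def esym_def eval_mpoly.hom_sum eval_mpoly.hom_prod)

lemma frag_cmul_eq_mult: "frag_cmul a p = of_int a * (p :: 'v int_mpoly)"
proof (induction a rule: int_induct[of _ 0])
  case (step1 i)
  then show ?case by (simp add: frag_cmul_distrib algebra_simps)
next
  case (step2 i)
  then show ?case by (simp add: frag_cmul_diff_distrib algebra_simps)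
qed simp

section \<open>Quantization\<close>

text \<open>This makes the \<open>THE\<close> in \<open>std_elem_coeffs\<close> unique. After
  evaluation, every monomial is padded to a product over all levels below a common bound
  \<open>N\<close>.\<close>

lemma std_elem_monomials_independent:
  assumes std: "Poly_Mapping.keys c \<subseteq> std_indices"
    and zero: "frag_extend std_elem_monomial c = 0"
  shows "c = 0"
proof (rule poly_mapping_eqI)
  fix I
  obtain N where N: "(\<Union>J\<in>Poly_Mapping.keys c. Poly_Mapping.keys J) \<subseteq> {0..<N}"
    using finite_nat_iff_bounded[of "\<Union>J\<in>Poly_Mapping.keys c. Poly_Mapping.keys J"]
    by (auto simp: lessThan_atLeast0)
  have "Poly_Mapping.lookup c I = 0" if "I \<in> Poly_Mapping.keys c"
  proof (rule esym_products_independent[where S = "Poly_Mapping.keys c" and k = 0 and N = N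
        and c = "Poly_Mapping.lookup c" and I = Poly_Mapping.lookup])
    show "Poly_Mapping.lookup J r \<le> r" if "J \<in> Poly_Mapping.keys c" for J r
      using that std by (auto simp: std_indices_def)
    show "J = J'" if "J \<in> Poly_Mapping.keys c" "J' \<in> Poly_Mapping.keys c"
      "\<And>r. r \<in> {0..<N} \<Longrightarrow> Poly_Mapping.lookup J r = Poly_Mapping.lookup J' r" for J J'
    proof (rule poly_mapping_eqI)
      fix r
      show "Poly_Mapping.lookup J r = Poly_Mapping.lookup J' r"
      proof (cases "r < N")
        case False
        then have "r \<notin> Poly_Mapping.keys J" "r \<notin> Poly_Mapping.keys J'"
          using N that(1,2) by (fastforce)+
        then show ?thesis by (simp add: in_keys_iff)
      qed (use that in simp)
    qed
    fix x :: "nat \<Rightarrow> int"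
    \<comment> \<open>Standard elementary monomials contain no \<open>Q\<close> variables, so the
      value 0 there is arbitrary.\<close>
    define y where "y v = (case v of X a \<Rightarrow> x a | Q _ _ \<Rightarrow> 0)" for v
    have mono: "eval_mpoly y (std_elem_monomial J) = (\<Prod>r=0..<N. esym x (Poly_Mapping.lookup J r) {1..r})"
      if "J \<in> Poly_Mapping.keys c" for J
    proof -
      have "eval_mpoly y (std_elem_monomial J) = (\<Prod>r\<in>Poly_Mapping.keys J. esym x (Poly_Mapping.lookup J r) {1..r})"
        by (simp add: std_elem_monomial_def eval_mpoly.hom_prod eval_elem_sym y_def)
      also have "\<dots> = (\<Prod>r=0..<N. esym x (Poly_Mapping.lookup J r) {1..r})"
        using N that by (intro prod.mono_neutral_left) (auto simp: not_in_keys_iff_lookup_eq_zero)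
      finally show ?thesis .
    qed
    have "0 = eval_mpoly y (frag_extend std_elem_monomial c)" using zero by simp
    also have "\<dots> = (\<Sum>J\<in>Poly_Mapping.keys c. Poly_Mapping.lookup c J *
        (\<Prod>r=0..<N. esym x (Poly_Mapping.lookup J r) {1..r}))"
      by (simp add: frag_extend_def frag_cmul_eq_mult eval_mpoly.hom_sum eval_mpoly.hom_mult mono)
    finally show "(\<Sum>J\<in>Poly_Mapping.keys c. Poly_Mapping.lookup c J *
        (\<Prod>r=0..<N. esym x (Poly_Mapping.lookup J r) {1..r})) = 0" by simp
  qed (use that in auto)
  then show "Poly_Mapping.lookup c I = Poly_Mapping.lookup 0 I"
    by (cases "I \<in> Poly_Mapping.keys c") (auto simp: in_keys_iff)
qed

text \<open>Any explicit combination of standard monomials may be quantized termwise, because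
  independence identifies it with the one chosen by \<open>THE\<close>.\<close>

lemma quantization_frag_extend:
  assumes "Poly_Mapping.keys c \<subseteq> std_indices"
  shows "quantization (frag_extend std_elem_monomial c) = frag_extend quantum_std_elem_monomial c"
proof -
  have "std_elem_coeffs (frag_extend std_elem_monomial c) = c"
    unfolding std_elem_coeffs_def
  proof (rule the_equality)
    fix c' assume c': "Poly_Mapping.keys c' \<subseteq> std_indices \<and> frag_extend std_elem_monomial c =
      (\<Sum>I\<in>Poly_Mapping.keys c'. of_int (Poly_Mapping.lookup c' I) * std_elem_monomial I)"
    then have "frag_extend std_elem_monomial c = frag_extend std_elem_monomial c'"
      by (simp add: frag_extend_def frag_cmul_eq_mult)
    then have "frag_extend std_elem_monomial (c' - c) = 0"
      by (simp add: frag_extend_diff)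
    moreover have "Poly_Mapping.keys (c' - c) \<subseteq> std_indices"
      using c' assms keys_diff[of c' c] by blast
    ultimately show "c' = c"
      using std_elem_monomials_independent[of "c' - c"] by simp
  qed (use assms in \<open>simp add: frag_extend_def frag_cmul_eq_mult\<close>)
  then show ?thesis
    by (simp add: quantization_def frag_extend_def frag_cmul_eq_mult)
qed

lemma quantization_0: "quantization 0 = 0"
  using quantization_frag_extend[of 0] by simp

lemma quantization_1: "quantization 1 = 1"
proof -
  have "frag_extend f 1 = f 0" for f :: "(nat \<Rightarrow>\<^sub>0 nat) \<Rightarrow> xq_var int_mpoly"
    using frag_extend_of[of f 0] by simp
  then show ?thesis
    using quantization_frag_extend[of "frag_of 0"]
    by (simp add: std_indices_def std_elem_monomial_def quantum_std_elem_monomial_def)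
qed

text \<open>The permutation \<open>p\<close> contributes a multiple of the monomial with index
  sequence \<open>r \<mapsto> d r (p r)\<close>. As \<open>F\<close> is arbitrary, one formal
  combination serves both \<open>elem_sym\<close> and \<open>E_poly\<close>;
  \<open>F 0 r = 1\<close> covers levels outside the support.\<close>

lemma det_as_frag_extend:
  fixes F :: "nat \<Rightarrow> nat \<Rightarrow> 'v int_mpoly"
  assumes F0: "\<And>r. r < n \<Longrightarrow> F 0 r = 1"
  shows "det (mat n n (\<lambda>(r, c). of_int (s r c) * F (d r c) r)) =
    frag_extend (\<lambda>I. \<Prod>k\<in>Poly_Mapping.keys I. F (Poly_Mapping.lookup I k) k)
      (\<Sum>p | p permutes {0..<n}. frag_cmul (sign p * (\<Prod>r=0..<n. s r (p r)))
         (frag_of (Abs_poly_mapping (\<lambda>r. if r < n then d r (p r) else 0))))"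
    (is "det ?A = frag_extend ?f (sum ?g ?P)")
proof -
  define J where "J p = Abs_poly_mapping (\<lambda>r. if r < n then d r (p r) else 0)" for p
  have J: "Poly_Mapping.lookup (J p) = (\<lambda>r. if r < n then d r (p r) else 0)" for p
    unfolding J_def by (rule Abs_poly_mapping_inverse) (auto intro: finite_subset[of _ "{..<n}"])
  have fJ: "?f (J p) = (\<Prod>r=0..<n. F (d r (p r)) r)" for p
  proof -
    have "?f (J p) = (\<Prod>r=0..<n. F (Poly_Mapping.lookup (J p) r) r)"
      using F0 by (intro prod.mono_neutral_left) (auto simp: in_keys_iff J split: if_splits)
    then show ?thesis by (simp add: J)
  qed
  have "frag_extend ?f (sum ?g ?P) = (\<Sum>p\<in>?P. of_int (sign p * (\<Prod>r=0..<n. s r (p r))) * ?f (J p))"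
    by (simp add: frag_extend_sum finite_permutations frag_extend_cmul J_def)
      (simp add: frag_cmul_eq_mult)
  also have "\<dots> = (\<Sum>p\<in>?P. signof p * (\<Prod>r=0..<n. ?A $$ (r, p r)))"
    by (intro sum.cong refl) (simp add: fJ prod.distrib mult.assoc permutes_in_image)
  also have "\<dots> = det ?A" by (subst det_def'[of _ n]) auto
  finally show ?thesis by simp
qed

lemma E_poly_0: "E_poly 0 j = 1"
  using degree_monic_char_poly[of "M_mat j" j] by (simp add: E_poly_def M_mat_def)

text \<open>Each row of the matrix involves a single level of elementary polynomials, so every term of the
  Leibniz expansion is a multiple of a standard elementary monomial.\<close>

lemma quantization_det:
  assumes "\<And>r c. r < n \<Longrightarrow> c < n \<Longrightarrow> d r c \<le> r"
  shows "quantization (det (mat n n (\<lambda>(r, c). of_int (s r c) * elem_sym (d r c) r))) =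
    det (mat n n (\<lambda>(r, c). of_int (s r c) * E_poly (d r c) r))"
proof -
  let ?J = "\<lambda>p. Abs_poly_mapping (\<lambda>r. if r < n then d r (p r) else 0)"
  let ?g = "\<lambda>p. frag_cmul (sign p * (\<Prod>r=0..<n. s r (p r))) (frag_of (?J p))"
  let ?c = "\<Sum>p | p permutes {0..<n}. ?g p"
  have "?J p \<in> std_indices" if "p permutes {0..<n}" for p
  proof -
    have "Poly_Mapping.lookup (?J p) = (\<lambda>r. if r < n then d r (p r) else 0)"
      by (rule Abs_poly_mapping_inverse) (auto intro: finite_subset[of _ "{..<n}"])
    then show ?thesis
      using assms permutes_in_image[OF that] by (auto simp: std_indices_def)
  qed
  then have "Poly_Mapping.keys ?c \<subseteq> std_indices"
    by (intro order.trans[OF keys_sum]) auto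
  from quantization_frag_extend[OF this] show ?thesis
    using det_as_frag_extend[of n elem_sym s d] det_as_frag_extend[of n E_poly s d]
    by (simp add: elem_sym_eq_esym E_poly_0
        std_elem_monomial_def[abs_def] quantum_std_elem_monomial_def[abs_def])
qed

section \<open>Minors of inverse matrices\<close>

lemma extend_to_permutation:
  assumes "inj_on \<iota> {0..<k}" "\<iota> ` {0..<k} \<subseteq> {0..<n :: nat}"
  obtains \<tau> where "\<tau> permutes {0..<n}" "\<And>a. a < k \<Longrightarrow> \<tau> a = \<iota> a"
proof -
  have kn: "k \<le> n" using card_inj_on_le[OF assms] by simp
  have "card {k..<n} = card ({0..<n} - \<iota> ` {0..<k})"
    using assms by (simp add: card_Diff_subset card_image)
  then obtain g where g: "bij_betw g {k..<n} ({0..<n} - \<iota> ` {0..<k})"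
    using finite_same_card_bij[of "{k..<n}" "{0..<n} - \<iota> ` {0..<k}"] by auto
  define \<tau> where "\<tau> a = (if a < k then \<iota> a else if a < n then g a else a)" for a
  have "bij_betw \<tau> ({0..<k} \<union> {k..<n}) (\<iota> ` {0..<k} \<union> ({0..<n} - \<iota> ` {0..<k}))"
  proof (rule bij_betw_combine)
    show "bij_betw \<tau> {0..<k} (\<iota> ` {0..<k})"
      using assms(1) by (auto simp: bij_betw_def inj_on_def \<tau>_def)
    show "bij_betw \<tau> {k..<n} ({0..<n} - \<iota> ` {0..<k})"
      using g by (subst bij_betw_cong[of _ _ g]) (auto simp: \<tau>_def)
  qed auto
  moreover have "{0..<k} \<union> {k..<n} = {0..<n}" using kn by auto
  moreover have "\<iota> ` {0..<k} \<union> ({0..<n} - \<iota> ` {0..<k}) = {0..<n}" using assms by auto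
  ultimately have "\<tau> permutes {0..<n}"
    using kn by (intro bij_imp_permutes) (auto simp: \<tau>_def)
  then show ?thesis using that by (auto simp: \<tau>_def)
qed

text \<open>One permutation moves the rows and the columns in the image of \<open>\<iota>\<close> to
  the front; its two signs cancel, and the result is block lower triangular with an identity
  block.\<close>

lemma det_unit_columns:
  fixes B :: "'a::idom mat"
  assumes \<iota>: "inj_on \<iota> {0..<k}" "\<iota> ` {0..<k} \<subseteq> {0..<n}" and B: "B \<in> carrier_mat n n"
    and unit: "\<And>r c. r < n \<Longrightarrow> c < n \<Longrightarrow> c \<notin> \<iota> ` {0..<k} \<Longrightarrow> B $$ (r, c) = (if r = c then 1 else 0)"
  shows "det B = det (mat k k (\<lambda>(a, b). B $$ (\<iota> a, \<iota> b)))"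
proof -
  obtain \<tau> where \<tau>: "\<tau> permutes {0..<n}" "\<And>a. a < k \<Longrightarrow> \<tau> a = \<iota> a"
    using extend_to_permutation[OF \<iota>] by blast
  have kn: "k \<le> n" using card_inj_on_le[OF \<iota>] by simp
  have \<tau>n: "\<tau> a < n" if "a < n" for a using permutes_in_image[OF \<tau>(1), of a] that by simp
  have \<tau>inj: "\<tau> a = \<tau> b \<longleftrightarrow> a = b" for a b using permutes_inj[OF \<tau>(1)] by (auto dest: injD)
  \<comment> \<open>Columns are permuted as rows of the transpose.\<close>
  define Bt where "Bt = mat n n (\<lambda>(i, j). B\<^sup>T $$ (\<tau> i, j))"
  define C where "C = mat n n (\<lambda>(i, j). Bt\<^sup>T $$ (\<tau> i, j))"
  have "det C = signof \<tau> * det (Bt\<^sup>T)"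
    unfolding C_def by (rule det_permute_rows[OF _ \<tau>(1)]) (simp add: Bt_def)
  also have "det (Bt\<^sup>T) = det Bt" by (rule det_transpose[of _ n]) (simp add: Bt_def)
  also have "\<dots> = signof \<tau> * det (B\<^sup>T)"
    unfolding Bt_def using B by (intro det_permute_rows[OF _ \<tau>(1)]) auto
  also have "det (B\<^sup>T) = det B" using B by (rule det_transpose)
  also have "signof \<tau> * (signof \<tau> * det B) = det B"
    by (simp add: sign_def)
  finally have detC: "det C = det B" .
  have Cij: "C $$ (i, j) = B $$ (\<tau> i, \<tau> j)" if "i < n" "j < n" for i j
    using that \<tau>n B by (simp add: C_def Bt_def)
  define A1 where "A1 = mat k k (\<lambda>(a, b). B $$ (\<iota> a, \<iota> b))"
  define A3 where "A3 = mat (n - k) k (\<lambda>(a, b). B $$ (\<tau> (a + k), \<iota> b))"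
  have "C = four_block_mat A1 (0\<^sub>m k (n - k)) A3 (1\<^sub>m (n - k))"
  proof (rule eq_matI)
    fix i j assume "i < dim_row (four_block_mat A1 (0\<^sub>m k (n - k)) A3 (1\<^sub>m (n - k)))"
      "j < dim_col (four_block_mat A1 (0\<^sub>m k (n - k)) A3 (1\<^sub>m (n - k)))"
    then have ij: "i < n" "j < n" using kn by (auto simp: A1_def)
    have "\<tau> j \<notin> \<iota> ` {0..<k}" if "k \<le> j"
    proof
      assume "\<tau> j \<in> \<iota> ` {0..<k}"
      then obtain a where "a < k" "\<tau> j = \<tau> a" using \<tau>(2) by auto
      with that \<tau>inj show False by simp
    qed
    then show "C $$ (i, j) = four_block_mat A1 (0\<^sub>m k (n - k)) A3 (1\<^sub>m (n - k)) $$ (i, j)"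
      using ij kn unit[of "\<tau> i" "\<tau> j"] \<tau>n \<tau>(2) \<tau>inj
      by (subst index_mat_four_block) (auto simp: Cij A1_def A3_def)
  qed (use kn in \<open>auto simp: C_def A1_def A3_def\<close>)
  then have "det C = det A1 * det (1\<^sub>m (n - k) :: 'a mat)"
    using det_four_block_mat_upper_right_zero[of A1 k _ "n - k" A3 "1\<^sub>m (n - k)"]
    by (simp add: A1_def A3_def)
  then show ?thesis using detC by (simp add: A1_def)
qed

text \<open>Jacobi's complementary minor formula, with the complementary minor of \<open>G\<close> padded by unit columns
  so that no sign appears.\<close>

lemma det_minor_of_inverse:
  fixes G H :: "'a::idom mat"
  assumes GH: "G \<in> carrier_mat n n" "H \<in> carrier_mat n n" "G * H = 1\<^sub>m n" "det G = 1"
    and \<iota>: "inj_on \<iota> {0..<k}" "\<iota> ` {0..<k} \<subseteq> {0..<n}" and \<kappa>: "\<kappa> ` {0..<k} \<subseteq> {0..<n}"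
  shows "det (mat k k (\<lambda>(a, b). H $$ (\<iota> a, \<kappa> b))) =
    det (mat n n (\<lambda>(r, c). if c \<in> \<iota> ` {0..<k}
      then (if r = \<kappa> (the_inv_into {0..<k} \<iota> c) then 1 else 0) else G $$ (r, c)))"
proof -
  let ?i = "the_inv_into {0..<k} \<iota>"
  \<comment> \<open>The identity with column \<open>\<iota> b\<close> replaced by column
    \<open>\<kappa> b\<close> of \<open>H\<close>: then \<open>G * B\<close> has a unit vector there
    and agrees with \<open>G\<close> in the other columns.\<close>
  define B where "B = mat n n (\<lambda>(r, c). if c \<in> \<iota> ` {0..<k} then H $$ (r, \<kappa> (?i c)) else if r = c then 1 else 0)"
  have B: "B \<in> carrier_mat n n" by (simp add: B_def)
  have \<kappa>n: "\<kappa> (?i c) < n" if "c \<in> \<iota> ` {0..<k}" for c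
    using \<kappa> the_inv_into_into[OF \<iota>(1) that, of "{0..<k}"] by (simp add: image_subset_iff)
  have "det B = det (mat k k (\<lambda>(a, b). B $$ (\<iota> a, \<iota> b)))"
    by (rule det_unit_columns[OF \<iota> B]) (simp add: B_def)
  also have "mat k k (\<lambda>(a, b). B $$ (\<iota> a, \<iota> b)) = mat k k (\<lambda>(a, b). H $$ (\<iota> a, \<kappa> b))"
    using \<iota> by (intro eq_matI) (auto simp: B_def the_inv_into_f_f image_subset_iff)
  also have "det B = det (G * B)" using det_mult[OF GH(1) B] GH(4) by simp
  also have "G * B = mat n n (\<lambda>(r, c). if c \<in> \<iota> ` {0..<k}
      then (if r = \<kappa> (?i c) then 1 else 0) else G $$ (r, c))"
  proof (rule eq_matI)
    fix r c assume "r < dim_row (mat n n (\<lambda>(r, c). if c \<in> \<iota> ` {0..<k}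
      then (if r = \<kappa> (?i c) then 1 else 0 :: 'a) else G $$ (r, c)))"
      "c < dim_col (mat n n (\<lambda>(r, c). if c \<in> \<iota> ` {0..<k}
      then (if r = \<kappa> (?i c) then 1 else 0 :: 'a) else G $$ (r, c)))"
    then have rc: "r < n" "c < n" by auto
    have GB: "(G * B) $$ (r, c) = (\<Sum>l=0..<n. G $$ (r, l) * B $$ (l, c))"
      using GH B rc by (simp add: scalar_prod_def)
    show "(G * B) $$ (r, c) = mat n n (\<lambda>(r, c). if c \<in> \<iota> ` {0..<k}
      then (if r = \<kappa> (?i c) then 1 else 0) else G $$ (r, c)) $$ (r, c)"
    proof (cases "c \<in> \<iota> ` {0..<k}")
      case True
      have "(G * B) $$ (r, c) = (\<Sum>l=0..<n. G $$ (r, l) * H $$ (l, \<kappa> (?i c)))"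
        using GB True rc by (simp add: B_def)
      also have "\<dots> = (G * H) $$ (r, \<kappa> (?i c))"
        using GH(1,2) rc \<kappa>n[OF True] by (simp add: scalar_prod_def)
      also have "\<dots> = (if r = \<kappa> (?i c) then 1 else 0)"
        unfolding GH(3) using rc \<kappa>n[OF True] by simp
      finally show ?thesis using True rc by simp
    next
      case False
      have "(G * B) $$ (r, c) = (\<Sum>l=0..<n. if l = c then G $$ (r, c) else 0)"
        unfolding GB using False rc by (intro sum.cong refl) (auto simp: B_def)
      then show ?thesis using False rc by simp
    qed
  qed (use GH B in auto)
  finally show ?thesis by simp
qed

text \<open>Matrix indices start at 0, so row \<open>r\<close> carries the polynomials of level \<open>r\<close>.\<close>

definition signed_mat :: "(nat \<Rightarrow> nat \<Rightarrow> 'a::comm_ring_1) \<Rightarrow> nat \<Rightarrow> 'a mat" where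
  "signed_mat F n = mat n n (\<lambda>(r, c). if c \<le> r then (- 1) ^ (r - c) * F (r - c) r else 0)"

lemma signed_mat_carrier [simp]: "signed_mat F n \<in> carrier_mat n n"
  by (simp add: signed_mat_def)

lemma det_signed_mat:
  assumes "\<And>r. F 0 r = 1"
  shows "det (signed_mat F n) = 1"
  by (subst det_lower_triangular[of n]) (auto simp: signed_mat_def prod_list_diag_prod assms)

text \<open>By \<open>det_minor_of_inverse\<close> both minors are determinants of the same shape,
  one in \<open>elem_sym\<close> and one in \<open>E_poly\<close>, and
  \<open>quantization_det\<close> exchanges these.\<close>

lemma quantization_minor:
  assumes inv: "h \<in> carrier_mat n n" "signed_mat elem_sym n * h = 1\<^sub>m n"
    "H \<in> carrier_mat n n" "signed_mat E_poly n * H = 1\<^sub>m n"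
    and \<iota>: "inj_on \<iota> {0..<k}" "\<iota> ` {0..<k} \<subseteq> {0..<n}" and \<kappa>: "\<kappa> ` {0..<k} \<subseteq> {0..<n}"
  shows "quantization (det (mat k k (\<lambda>(a, b). h $$ (\<iota> a, \<kappa> b)))) =
    det (mat k k (\<lambda>(a, b). H $$ (\<iota> a, \<kappa> b)))"
proof -
  \<comment> \<open>In the replaced columns, and above the diagonal by truncated subtraction,
    \<open>d\<close> is 0; there \<open>F 0 r = 1\<close> makes the entry the constant
    \<open>s r c\<close>. Hence \<open>d r c \<le> r\<close> everywhere.\<close>
  define s :: "nat \<Rightarrow> nat \<Rightarrow> int" where "s r c = (if c \<in> \<iota> ` {0..<k}
      then (if r = \<kappa> (the_inv_into {0..<k} \<iota> c) then 1 else 0)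
      else if c \<le> r then (- 1) ^ (r - c) else 0)" for r c
  define d where "d r c = (if c \<in> \<iota> ` {0..<k} then 0 else r - c)" for r c
  have minor: "det (mat k k (\<lambda>(a, b). M $$ (\<iota> a, \<kappa> b))) =
      det (mat n n (\<lambda>(r, c). of_int (s r c) * F (d r c) r))"
    if "\<And>r. F 0 r = 1" "M \<in> carrier_mat n n" "signed_mat F n * M = 1\<^sub>m n"
    for F :: "nat \<Rightarrow> nat \<Rightarrow> xq_var int_mpoly" and M
  proof -
    have "mat n n (\<lambda>(r, c). if c \<in> \<iota> ` {0..<k} then (if r = \<kappa> (the_inv_into {0..<k} \<iota> c) then 1 else 0)
        else signed_mat F n $$ (r, c)) = mat n n (\<lambda>(r, c). of_int (s r c) * F (d r c) r)"
      using that(1) by (intro eq_matI) (auto simp: signed_mat_def s_def d_def)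
    moreover have det1: "det (signed_mat F n) = 1" using that(1) by (rule det_signed_mat)
    ultimately show ?thesis
      using det_minor_of_inverse[OF signed_mat_carrier that(2,3) det1 \<iota> \<kappa>] by simp
  qed
  show ?thesis
    using minor[of elem_sym h] minor[of E_poly H] inv quantization_det[of n d s]
    by (simp add: elem_sym_eq_esym E_poly_0 d_def)
qed

section \<open>Two pairs of inverse unitriangular matrices\<close>

definition h_mat :: "nat \<Rightarrow> xq_var int_mpoly mat" where
  "h_mat n = mat n n (\<lambda>(i, j). if j \<le> i then complete_sym (i - j) (Suc j) else 0)"

definition H_mat :: "nat \<Rightarrow> xq_var int_mpoly mat" where
  "H_mat n = mat n n (\<lambda>(i, j). if j \<le> i then H_poly (i - j) (Suc j) else 0)"

text \<open>For \<open>j < i\<close> the entry is, up to sign, the elementary polynomial of degree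
  \<open>i - j\<close> in the \<open>i - j - 1\<close> variables with indices \<open>j + 2\<close>
  to \<open>i\<close>, hence 0.\<close>

lemma signed_mat_mult_h_mat: "signed_mat elem_sym n * h_mat n = 1\<^sub>m n"
proof (rule eq_matI)
  fix i j assume "i < dim_row (1\<^sub>m n :: xq_var int_mpoly mat)" "j < dim_col (1\<^sub>m n :: xq_var int_mpoly mat)"
  then have ij: "i < n" "j < n" by auto
  define t where "t l = (- 1) ^ (i - l) * elem_sym (i - l) i * complete_sym (l - j) (Suc j)" for l
  have "(signed_mat elem_sym n * h_mat n) $$ (i, j) = (\<Sum>l=0..<n. if l \<in> {j..i} then t l else 0)"
    using ij by (auto simp: signed_mat_def h_mat_def scalar_prod_def t_def intro!: sum.cong)
  also have "\<dots> = (\<Sum>l\<in>{j..i}. t l)"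
    using ij by (subst sum.inter_restrict[symmetric]) (auto intro!: sum.cong)
  also have "\<dots> = (if i = j then 1 else 0)"
  proof (cases "j < i")
    case True
    have "(\<Sum>l\<in>{j..i}. t l) = (\<Sum>l\<in>{0..i - j}. t (i - l))"
      using True by (intro sum.reindex_bij_witness[of _ "\<lambda>l. i - l" "\<lambda>l. i - l"]) auto
    also have "\<dots> = (\<Sum>l=0..i - j. (- 1) ^ l * esym x_var l {1..i} * hsym x_var (i - j - l) {1..Suc j})"
      using True by (intro sum.cong refl)
        (simp add: t_def elem_sym_eq_esym complete_sym_eq_hsym diff_commute add.commute)
    also have "\<dots> = (- 1) ^ (i - j) * esym x_var (i - j) ({1..i} - {1..Suc j})"
      using True by (intro alternating_esym_hsym) auto
    also have "esym x_var (i - j) ({1..i} - {1..Suc j}) = 0"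
      using True by (intro esym_eq_0) (auto simp: card_Diff_subset)
    finally show ?thesis using True by simp
  next
    case False
    then show ?thesis
      by (cases "i = j") (auto simp: t_def elem_sym_eq_esym complete_sym_eq_hsym)
  qed
  finally show "(signed_mat elem_sym n * h_mat n) $$ (i, j) = (1\<^sub>m n) $$ (i, j)"
    using ij by simp
qed (auto simp: signed_mat_def h_mat_def)

text \<open>The adjugate is the inverse because the determinant is 1. Each of its entries is a 1 by
  1 minor, which \<open>quantization_minor\<close> identifies as the quantization of an entry of
  \<open>h_mat\<close>.\<close>

lemma H_mat_eq_adj_mat: "H_mat n = adj_mat (signed_mat E_poly n)"
proof -
  let ?G = "signed_mat E_poly n" and ?A = "adj_mat (signed_mat E_poly n)"
  have A: "?A \<in> carrier_mat n n" "?G * ?A = 1\<^sub>m n"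
    using adj_mat(1,2)[of ?G n] by (auto simp: det_signed_mat E_poly_0 intro!: eq_matI)
  have "?A = H_mat n"
  proof (rule eq_matI)
    fix i j assume "i < dim_row (H_mat n)" "j < dim_col (H_mat n)"
    then have ij: "i < n" "j < n" by (auto simp: H_mat_def)
    have one: "det (mat 1 1 (\<lambda>(a, b). M $$ (i, j))) = M $$ (i, j)" for M :: "xq_var int_mpoly mat"
      by (subst det_lower_triangular[of 1]) (auto simp: prod_list_diag_prod)
    have "quantization (det (mat 1 1 (\<lambda>(a, b). h_mat n $$ (i, j)))) =
        det (mat 1 1 (\<lambda>(a, b). ?A $$ (i, j)))"
      by (rule quantization_minor[OF _ signed_mat_mult_h_mat A]) (use ij in \<open>auto simp: h_mat_def\<close>)
    then have "?A $$ (i, j) = quantization (h_mat n $$ (i, j))"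
      unfolding one ..
    also have "\<dots> = H_mat n $$ (i, j)"
      using ij by (simp add: h_mat_def H_mat_def H_poly_def quantization_0)
    finally show "?A $$ (i, j) = H_mat n $$ (i, j)" .
  qed (use A in \<open>auto simp: H_mat_def\<close>)
  then show ?thesis by simp
qed

lemma signed_mat_mult_H_mat: "signed_mat E_poly n * H_mat n = 1\<^sub>m n"
  using adj_mat(2)[of "signed_mat E_poly n" n]
  by (auto simp: H_mat_eq_adj_mat det_signed_mat E_poly_0 intro!: eq_matI)

section \<open>Schur polynomials as minors\<close>

text \<open>Complete polynomials are the divided differences of powers. The induction combines
  \<open>y * N c = N (Suc c) + x (Suc c) * N c\<close> for the Newton products with
  \<open>hsym_insert\<close>.\<close>

lemma newton_expansion:
  fixes x :: "nat \<Rightarrow> 'a::comm_ring_1"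
  shows "y ^ m = (\<Sum>c\<le>m. hsym x (m - c) {1..Suc c} * (\<Prod>d=1..c. y - x d))"
proof (induction m)
  case (Suc m)
  define N where "N c = (\<Prod>d=1..c. y - x d)" for c
  have N_Suc: "N (Suc c) = N c * (y - x (Suc c))" for c by (simp add: N_def mult.commute)
  have rec: "hsym x (Suc m - c) {1..Suc c} = hsym x (Suc m - c) {1..c} + x (Suc c) * hsym x (m - c) {1..Suc c}"
    if "c \<le> m" for c
    using that hsym_insert[of "{1..c}" "Suc c" x "m - c"] by (simp add: Suc_diff_le atLeastAtMostSuc_conv)
  have "(\<Sum>c\<le>Suc m. hsym x (Suc m - c) {1..Suc c} * N c)
      = (\<Sum>c\<le>m. (hsym x (Suc m - c) {1..c} + x (Suc c) * hsym x (m - c) {1..Suc c}) * N c) + N (Suc m)"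
    using rec by simp
  also have "\<dots> = (\<Sum>c\<le>Suc m. hsym x (Suc m - c) {1..c} * N c) + (\<Sum>c\<le>m. x (Suc c) * hsym x (m - c) {1..Suc c} * N c)"
    by (simp add: distrib_right sum.distrib)
  also have "(\<Sum>c\<le>Suc m. hsym x (Suc m - c) {1..c} * N c) = (\<Sum>c\<le>m. hsym x (m - c) {1..Suc c} * N (Suc c))"
    by (subst sum.atMost_Suc_shift) (simp add: hsym_empty)
  also have "\<dots> + (\<Sum>c\<le>m. x (Suc c) * hsym x (m - c) {1..Suc c} * N c)
      = y * (\<Sum>c\<le>m. hsym x (m - c) {1..Suc c} * N c)"
    unfolding sum.distrib[symmetric] sum_distrib_left
    by (intro sum.cong refl) (simp add: N_Suc algebra_simps)
  also have "\<dots> = y ^ Suc m" using Suc by (simp add: N_def)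
  finally show ?case by (simp add: N_def)
qed simp

lemma Var_eq_iff [simp]: "Var v = Var w \<longleftrightarrow> v = w"
  unfolding Var_def by (metis lookup_single_eq lookup_single_not_eq zero_neq_one)

definition newton_mat :: "nat \<Rightarrow> xq_var int_mpoly mat" where
  "newton_mat k = mat k k (\<lambda>(c, b). \<Prod>d=1..c. x_var (Suc b) - x_var d)"

text \<open>The product in row \<open>c\<close> vanishes at the variable of column
  \<open>b < c\<close>; the diagonal entries are products of differences of distinct
  variables.\<close>

lemma det_newton_mat_neq_0: "det (newton_mat k) \<noteq> 0"
  by (subst det_upper_triangular[of _ k])
    (auto simp: newton_mat_def upper_triangular_def prod_list_diag_prod intro!: prod_zero)

definition h_minor_mat :: "nat \<Rightarrow> (nat \<Rightarrow> nat) \<Rightarrow> xq_var int_mpoly mat" where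
  "h_minor_mat k \<rho> = mat k k (\<lambda>(a, c). if c \<le> \<rho> a then complete_sym (\<rho> a - c) (Suc c) else 0)"

lemma h_minor_mat_mult_newton_mat:
  "h_minor_mat k \<rho> * newton_mat k = mat k k (\<lambda>(a, b). x_var (Suc b) ^ \<rho> a)"
proof (rule eq_matI)
  fix a b assume "a < dim_row (mat k k (\<lambda>(a, b). x_var (Suc b) ^ \<rho> a))"
    "b < dim_col (mat k k (\<lambda>(a, b). x_var (Suc b) ^ \<rho> a))"
  then have ab: "a < k" "b < k" by auto
  define N where "N c = (\<Prod>d=1..c. x_var (Suc b) - x_var d)" for c
  \<comment> \<open>Newton products of index at least \<open>k\<close> thus vanish, so the sums up
    to \<open>k\<close> and up to \<open>\<rho> a\<close> agree.\<close>
  have N0: "N c = 0" if "b < c" for c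
    unfolding N_def using that by (intro prod_zero) (auto intro!: bexI[of _ "Suc b"])
  have "(h_minor_mat k \<rho> * newton_mat k) $$ (a, b)
      = (\<Sum>c=0..<k. if c \<le> \<rho> a then complete_sym (\<rho> a - c) (Suc c) * N c else 0)"
    using ab by (auto simp: h_minor_mat_def newton_mat_def scalar_prod_def N_def intro!: sum.cong)
  also have "\<dots> = (\<Sum>c\<le>\<rho> a. complete_sym (\<rho> a - c) (Suc c) * N c)"
    using N0 ab by (intro sum.mono_neutral_cong) auto
  also have "\<dots> = x_var (Suc b) ^ \<rho> a"
    by (subst newton_expansion[of _ _ x_var]) (simp add: complete_sym_eq_hsym N_def)
  finally show "(h_minor_mat k \<rho> * newton_mat k) $$ (a, b) = mat k k (\<lambda>(a, b). x_var (Suc b) ^ \<rho> a) $$ (a, b)"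
    using ab by simp
qed (auto simp: h_minor_mat_def newton_mat_def)

text \<open>Both alternants factor through \<open>newton_mat\<close> with the same sign, so their
  quotient is a quotient of minors of complete polynomials; the denominator is
  unitriangular.\<close>

lemma schur_eq_det_h:
  assumes \<mu>: "\<And>a. a < k \<Longrightarrow> \<mu> (Suc a) + (k - Suc a) = \<rho> (k - Suc a)"
  shows "schur k \<mu> = det (h_minor_mat k \<rho>)"
proof -
  \<comment> \<open>Alternants number their rows in the order opposite to
    \<open>h_minor_mat\<close>; \<open>p\<close> reverses it and fixes everything from
    \<open>k\<close> on, as \<open>permutes\<close> demands.\<close>
  define p where "p a = (if a < k then k - Suc a else a)" for a
  have "bij_betw p {0..<k} {0..<k}"
    by (rule bij_betw_byWitness[of _ p]) (auto simp: p_def)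
  then have p: "p permutes {0..<k}"
    by (intro bij_imp_permutes) (auto simp: p_def)
  have alt: "alternant k \<nu> = signof p * det (h_minor_mat k \<sigma>) * det (newton_mat k)"
    if "\<And>a. a < k \<Longrightarrow> \<nu> (Suc a) + (k - Suc a) = \<sigma> (k - Suc a)" for \<nu> \<sigma>
  proof -
    have "mat k k (\<lambda>(a, b). x_var (Suc b) ^ (\<nu> (Suc a) + (k - Suc a)))
        = h_minor_mat k (\<sigma> \<circ> p) * newton_mat k"
      unfolding h_minor_mat_mult_newton_mat using that by (intro eq_matI) (auto simp: p_def)
    then have "alternant k \<nu> = det (h_minor_mat k (\<sigma> \<circ> p)) * det (newton_mat k)"
      unfolding alternant_def
      by (subst det_mult[symmetric, of _ k]) (auto simp: h_minor_mat_def newton_mat_def)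
    also have "h_minor_mat k (\<sigma> \<circ> p) = mat k k (\<lambda>(a, c). h_minor_mat k \<sigma> $$ (p a, c))"
      by (intro eq_matI) (auto simp: h_minor_mat_def p_def)
    also have "det \<dots> = signof p * det (h_minor_mat k \<sigma>)"
      by (rule det_permute_rows[OF _ p]) (simp add: h_minor_mat_def)
    finally show ?thesis .
  qed
  have "det (h_minor_mat k id) = 1"
    by (subst det_lower_triangular[of k])
      (auto simp: h_minor_mat_def prod_list_diag_prod complete_sym_eq_hsym)
  then have alt0: "alternant k (\<lambda>_. 0) = signof p * det (newton_mat k)"
    using alt[of "\<lambda>_. 0" id] by simp
  have nz: "alternant k (\<lambda>_. 0) \<noteq> 0"
    unfolding alt0 using det_newton_mat_neq_0[of k] by (simp add: sign_def)
  have D: "det (h_minor_mat k \<rho>) * alternant k (\<lambda>_. 0) = alternant k \<mu>"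
    using alt[of \<mu> \<rho>] \<mu> by (simp add: alt0)
  show ?thesis unfolding schur_def
  proof (rule the_equality)
    show "det (h_minor_mat k \<rho>) * alternant k (\<lambda>_. 0) = alternant k \<mu>" by (rule D)
  next
    fix s assume "s * alternant k (\<lambda>_. 0) = alternant k \<mu>"
    with D have "s * alternant k (\<lambda>_. 0) = det (h_minor_mat k \<rho>) * alternant k (\<lambda>_. 0)" by simp
    with nz show "s = det (h_minor_mat k \<rho>)" by simp
  qed
qed

text \<open>The theorem holds already in \<open>R_ring n\<close>, before passing to the quotient.\<close>

lemma S_poly_eq_det_H:
  assumes "inj_on \<rho> {0..<k}" "\<rho> ` {0..<k} \<subseteq> {0..<n}" "k \<le> n"
    and "\<And>a. a < k \<Longrightarrow> \<mu> (Suc a) + (k - Suc a) = \<rho> (k - Suc a)"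
  shows "S_poly k \<mu> = det (mat k k (\<lambda>(a, b). H_mat n $$ (\<rho> a, b)))"
proof -
  have "h_minor_mat k \<rho> = mat k k (\<lambda>(a, b). h_mat n $$ (\<rho> a, b))"
    using assms(2,3) by (intro eq_matI) (auto simp: h_minor_mat_def h_mat_def image_subset_iff)
  then have "S_poly k \<mu> = quantization (det (mat k k (\<lambda>(a, b). h_mat n $$ (\<rho> a, b))))"
    unfolding S_poly_def using schur_eq_det_h[of k \<mu> \<rho>] assms(4) by simp
  also have "\<dots> = det (mat k k (\<lambda>(a, b). H_mat n $$ (\<rho> a, b)))"
    using assms(3)
    by (intro quantization_minor[OF _ signed_mat_mult_h_mat _ signed_mat_mult_H_mat assms(1,2)])
      (auto simp: h_mat_def H_mat_def)
  finally show ?thesis .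
qed

section \<open>Passage to the quotient ring\<close>

text \<open>The Leibniz formula uses only ring operations. A predicate on one argument gives closure
  of subrings; equality of images under two homomorphisms gives transport of determinants.\<close>

lemma det_related:
  fixes A :: "'a::comm_ring_1 mat" and B :: "'b::comm_ring_1 mat"
  assumes one: "P 1 1"
    and add: "\<And>a b c d. P a b \<Longrightarrow> P c d \<Longrightarrow> P (a + c) (b + d)"
    and mult: "\<And>a b c d. P a b \<Longrightarrow> P c d \<Longrightarrow> P (a * c) (b * d)"
    and uminus: "\<And>a b. P a b \<Longrightarrow> P (- a) (- b)"
    and AB: "A \<in> carrier_mat n n" "B \<in> carrier_mat n n"
    and entries: "\<And>i j. i < n \<Longrightarrow> j < n \<Longrightarrow> P (A $$ (i, j)) (B $$ (i, j))"
  shows "P (det A) (det B)"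
proof -
  have zero: "P 0 0" using add[OF one uminus[OF one]] by simp
  have sum: "P (sum f S) (sum g S)" if "\<And>s. s \<in> S \<Longrightarrow> P (f s) (g s)" for f g and S :: "(nat \<Rightarrow> nat) set"
    using that by (induction S rule: infinite_finite_induct) (auto intro: zero add)
  have prod: "P (prod f S) (prod g S)" if "\<And>s. s \<in> S \<Longrightarrow> P (f s) (g s)" for f g and S :: "nat set"
    using that by (induction S rule: infinite_finite_induct) (auto intro: one mult)
  have "P (signof p) (signof p)" for p :: "nat \<Rightarrow> nat"
    using one uminus[OF one] by (simp add: sign_def)
  then show ?thesis
    unfolding det_def'[OF AB(1)] det_def'[OF AB(2)]
    by (intro sum mult prod entries) (auto simp: permutes_in_image)
qed

section \<open>Membership in the polynomial rings\<close>

lemma mpoly_ring_simps: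
  "monoid.mult (mpoly_ring V) = (*)" "one (mpoly_ring V) = 1" "zero (mpoly_ring V) = 0"
  "add (mpoly_ring V) = (+)"
  by (simp_all add: mpoly_ring_def)

lemma vars_Var: "vars (Var v) = {v}"
  by (simp add: vars_def Var_def)

lemma mpoly_ring_closed:
  shows "0 \<in> carrier (mpoly_ring V)" "1 \<in> carrier (mpoly_ring V)"
    and "p \<in> carrier (mpoly_ring V) \<Longrightarrow> q \<in> carrier (mpoly_ring V) \<Longrightarrow> p + q \<in> carrier (mpoly_ring V)"
    and "p \<in> carrier (mpoly_ring V) \<Longrightarrow> q \<in> carrier (mpoly_ring V) \<Longrightarrow> p * q \<in> carrier (mpoly_ring V)"
    and "p \<in> carrier (mpoly_ring V) \<Longrightarrow> - p \<in> carrier (mpoly_ring V)"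
    and "v \<in> V \<Longrightarrow> Var v \<in> carrier (mpoly_ring V)"
  using vars_add[of p q] vars_mult[of p q]
  by (auto simp: mpoly_ring_def vars_uminus vars_def[of 0] vars_def[of 1] vars_Var)

lemma mpoly_ring_sum_closed:
  "(\<And>s. s \<in> S \<Longrightarrow> f s \<in> carrier (mpoly_ring V)) \<Longrightarrow> sum f S \<in> carrier (mpoly_ring V)"
  by (induction S rule: infinite_finite_induct) (auto intro: mpoly_ring_closed)

lemma mpoly_ring_a_inv:
  assumes "p \<in> carrier (mpoly_ring V)"
  shows "a_inv (mpoly_ring V) p = - p"
proof -
  interpret cring "mpoly_ring V" by (rule cring_mpoly_ring)
  show ?thesis
    using assms by (intro minus_equality) (auto simp: mpoly_ring_simps intro: mpoly_ring_closed)
qed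

lemma det_mpoly_ring_closed:
  assumes "A \<in> carrier_mat n n"
    and "\<And>i j. i < n \<Longrightarrow> j < n \<Longrightarrow> A $$ (i, j) \<in> carrier (mpoly_ring V)"
  shows "det A \<in> carrier (mpoly_ring V)"
  using det_related[of "\<lambda>p _. p \<in> carrier (mpoly_ring V)" A n A] assms
  by (blast intro: mpoly_ring_closed)

text \<open>\<open>det_related\<close> is applied to the polynomials all of whose coefficients lie
  in the subring; the relation ignores its second argument.\<close>

lemma coeff_char_poly_closed:
  assumes A: "A \<in> carrier_mat n n"
    and entries: "\<And>i j. i < n \<Longrightarrow> j < n \<Longrightarrow> A $$ (i, j) \<in> carrier (mpoly_ring V)"
  shows "coeff (char_poly A) l \<in> carrier (mpoly_ring V)"
proof -
  define P where "P p (q :: 'a int_mpoly poly) \<longleftrightarrow> (\<forall>l. coeff p l \<in> carrier (mpoly_ring V))"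
    for p q :: "'a int_mpoly poly"
  have "P (det (char_poly_matrix A)) (det (char_poly_matrix A))"
  proof (rule det_related)
    fix i j assume ij: "i < n" "j < n"
    have "coeff (char_poly_matrix A $$ (i, j)) l \<in> carrier (mpoly_ring V)" for l
      using entries[OF ij] A ij
      by (auto simp: char_poly_matrix_def coeff_pCons intro: mpoly_ring_closed split: nat.splits)
    then show "P (char_poly_matrix A $$ (i, j)) (char_poly_matrix A $$ (i, j))"
      by (simp add: P_def)
  qed (use A in \<open>auto simp: P_def coeff_mult intro!: mpoly_ring_closed mpoly_ring_sum_closed\<close>)
  then show ?thesis by (simp add: P_def char_poly_def)
qed

abbreviation R_vars :: "nat \<Rightarrow> xq_var set" where
  "R_vars n \<equiv> {X i |i. 1 \<le> i \<and> i \<le> n} \<union> {Q i j |i j. 1 \<le> i \<and> i < j \<and> j \<le> n}"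

abbreviation ZU_vars :: "nat \<Rightarrow> (nat \<times> nat) set" where
  "ZU_vars n \<equiv> {(i, j). 1 \<le> j \<and> j < i \<and> i \<le> n}"

lemma E_poly_closed:
  assumes "j \<le> n"
  shows "E_poly i j \<in> carrier (R_ring n)"
proof -
  have "coeff (char_poly (M_mat j)) l \<in> carrier (R_ring n)" for l
    unfolding R_ring_def using assms
    by (intro coeff_char_poly_closed[of _ j]) (auto simp: M_mat_def intro!: mpoly_ring_closed)
  moreover have "(- 1) ^ i \<in> carrier (R_ring n)"
    unfolding R_ring_def by (induction i) (auto intro: mpoly_ring_closed)
  ultimately show ?thesis
    unfolding E_poly_def R_ring_def by (auto intro: mpoly_ring_closed)
qed

text \<open>The definition of \<open>quantization\<close> does not show which variables occur; the
  adjugate gives the entries as signed minors of a matrix of \<open>E_poly\<close> of levels below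
  \<open>n\<close>.\<close>

lemma H_mat_closed:
  assumes "i < n" "j < n"
  shows "H_mat n $$ (i, j) \<in> carrier (R_ring n)"
proof -
  let ?G = "signed_mat E_poly n"
  have m1: "(- 1) ^ i \<in> carrier (R_ring n)" for i
    unfolding R_ring_def by (induction i) (auto intro: mpoly_ring_closed)
  have G: "?G $$ (r, c) \<in> carrier (R_ring n)" if "r < n" "c < n" for r c
    using m1 E_poly_closed[of r n] that unfolding R_ring_def
    by (auto simp: signed_mat_def intro: mpoly_ring_closed)
  have "det (mat_delete ?G j i) \<in> carrier (R_ring n)"
    unfolding R_ring_def
  proof (rule det_mpoly_ring_closed)
    show "mat_delete ?G j i \<in> carrier_mat (n - 1) (n - 1)"
      by (rule mat_delete_carrier) simp
    show "mat_delete ?G j i $$ (r, c) \<in> carrier (mpoly_ring (R_vars n))"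
      if "r < n - 1" "c < n - 1" for r c
      using that G by (simp add: mat_delete_def R_ring_def carrier_matD[OF signed_mat_carrier])
  qed
  then show ?thesis
    using assms m1 unfolding R_ring_def
    by (auto simp: H_mat_eq_adj_mat adj_mat_def cofactor_def signed_mat_def intro: mpoly_ring_closed)
qed

lemma to_Q_ring_hom: "to_Q n \<in> Ring.ring_hom (R_ring n) (Q_ring n)"
  and ring_Q_ring: "ring (Q_ring n)"
proof -
  interpret R: cring "R_ring n" unfolding R_ring_def by (rule cring_mpoly_ring)
  interpret ideal "E_ideal n" "R_ring n"
    unfolding E_ideal_def by (rule R.genideal_ideal) (use E_poly_closed in auto)
  show "to_Q n \<in> Ring.ring_hom (R_ring n) (Q_ring n)"
    using rcos_ring_hom by (simp add: to_Q_def[abs_def] Q_ring_def)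
  show "ring (Q_ring n)" using quotient_is_ring by (simp add: Q_ring_def)
qed

text \<open>The maps respect the operations only on the carriers, so the relation must carry
  membership along with equality of images.\<close>

lemma ring_hom_det_eq:
  assumes S: "ring S"
    and \<phi>: "\<phi> \<in> Ring.ring_hom (mpoly_ring V) S" and \<psi>: "\<psi> \<in> Ring.ring_hom (mpoly_ring W) S"
    and AB: "A \<in> carrier_mat k k" "B \<in> carrier_mat k k"
    and A: "\<And>i j. i < k \<Longrightarrow> j < k \<Longrightarrow> A $$ (i, j) \<in> carrier (mpoly_ring V)"
    and B: "\<And>i j. i < k \<Longrightarrow> j < k \<Longrightarrow> B $$ (i, j) \<in> carrier (mpoly_ring W)"
    and eq: "\<And>i j. i < k \<Longrightarrow> j < k \<Longrightarrow> \<phi> (A $$ (i, j)) = \<psi> (B $$ (i, j))"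
  shows "\<phi> (det A) = \<psi> (det B)"
proof -
  interpret \<phi>: ring_hom_ring "mpoly_ring V" S \<phi>
    using \<phi> S cring_mpoly_ring[of V] by (intro ring_hom_ringI2) (auto simp: cring_def)
  interpret \<psi>: ring_hom_ring "mpoly_ring W" S \<psi>
    using \<psi> S cring_mpoly_ring[of W] by (intro ring_hom_ringI2) (auto simp: cring_def)
  define P where "P p q \<longleftrightarrow> p \<in> carrier (mpoly_ring V) \<and> q \<in> carrier (mpoly_ring W) \<and> \<phi> p = \<psi> q" for p q
  have "P (det A) (det B)"
  proof (rule det_related[OF _ _ _ _ AB])
    show "P 1 1"
      using \<phi>.hom_one \<psi>.hom_one by (simp add: P_def mpoly_ring_simps mpoly_ring_closed)
    fix a b c d assume "P a b" "P c d"
    then show "P (a + c) (b + d)" "P (a * c) (b * d)"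
      using \<phi>.hom_add[of a c] \<psi>.hom_add[of b d] \<phi>.hom_mult[of a c] \<psi>.hom_mult[of b d]
      by (simp_all add: P_def mpoly_ring_simps mpoly_ring_closed)
  next
    fix a b assume "P a b"
    then show "P (- a) (- b)"
      using \<phi>.hom_a_inv[of a] \<psi>.hom_a_inv[of b]
      by (simp add: P_def mpoly_ring_a_inv mpoly_ring_closed)
  next
    fix i j assume "i < k" "j < k"
    then show "P (A $$ (i, j)) (B $$ (i, j))" using A B eq by (simp add: P_def)
  qed
  then show ?thesis by (simp add: P_def)
qed

theorem theorem1p3:
  fixes n k :: nat
    and \<iota> \<mu> :: "nat \<Rightarrow> nat"
    and \<phi> :: "(nat \<times> nat) int_mpoly \<Rightarrow> xq_var int_mpoly set"
  assumes "0 < k" and "k < n"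
    and "strict_mono_on {1..k} \<iota>"
    and "\<iota> ` {1..k} \<subseteq> {1..n}"
    and "\<And>p. p \<in> {1..k} \<Longrightarrow> \<mu> (k + 1 - p) = \<iota> p - p"
    and "\<phi> \<in> Ring.ring_hom (ZU_ring n) (Q_ring n)"
    and "\<And>i j. 1 \<le> j \<Longrightarrow> j < i \<Longrightarrow> i \<le> n \<Longrightarrow> \<phi> (Var (i, j)) = to_Q n (H_poly (i - j) j)"
  shows "\<phi> (flag_minor k \<iota>) = to_Q n (S_poly k \<mu>)"
proof -
  \<comment> \<open>The row indices shifted to start at 0.\<close>
  define \<rho> where "\<rho> a = \<iota> (Suc a) - 1" for a
  have \<iota>: "1 \<le> \<iota> p" "\<iota> p \<le> n" if "p \<in> {1..k}" for p
    using assms(4) that by (auto simp: image_subset_iff)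
  \<comment> \<open>Ensures that the difference in the hypothesis on \<open>\<mu>\<close> is not
    truncated.\<close>
  have \<iota>_ge: "p \<le> \<iota> p" if "p \<in> {1..k}" for p
    using that
  proof (induction p)
    case (Suc p)
    show ?case
    proof (cases "p = 0")
      case False
      with Suc have "p \<le> \<iota> p" "\<iota> p < \<iota> (Suc p)"
        using assms(3) by (auto simp: strict_mono_on_def)
      then show ?thesis by simp
    qed (use \<iota>[of 1] Suc in auto)
  qed simp
  have "inj_on \<rho> {0..<k}"
  proof (rule inj_onI)
    fix a b assume ab: "a \<in> {0..<k}" "b \<in> {0..<k}" "\<rho> a = \<rho> b"
    then have "\<iota> (Suc a) = \<iota> (Suc b)"
      using \<iota>(1)[of "Suc a"] \<iota>(1)[of "Suc b"] by (simp add: \<rho>_def)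
    then show "a = b"
      using strict_mono_on_imp_inj_on[OF assms(3)] ab by (auto dest: inj_onD)
  qed
  moreover have \<rho>n: "\<rho> a < n" if "a < k" for a
    using \<iota>[of "Suc a"] that by (simp add: \<rho>_def)
  \<comment> \<open>With \<open>p = k - a\<close> the exponent is
    \<open>(\<iota> p - p) + (p - 1) = \<iota> p - 1\<close>.\<close>
  moreover have "\<mu> (Suc a) + (k - Suc a) = \<rho> (k - Suc a)" if "a < k" for a
  proof -
    have p: "k - a \<in> {1..k}" "k + 1 - (k - a) = Suc a" "Suc (k - Suc a) = k - a"
      using that by auto
    then show ?thesis
      using assms(5)[OF p(1)] \<iota>_ge[OF p(1)] that unfolding \<rho>_def by simp
  qed
  ultimately have S: "S_poly k \<mu> = det (mat k k (\<lambda>(a, b). H_mat n $$ (\<rho> a, b)))"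
    using assms(2) by (intro S_poly_eq_det_H) auto
  show ?thesis unfolding S flag_minor_def
  proof (rule ring_hom_det_eq[OF ring_Q_ring])
    show "\<phi> \<in> Ring.ring_hom (mpoly_ring (ZU_vars n)) (Q_ring n)"
      using assms(6) by (simp add: ZU_ring_def)
    show "to_Q n \<in> Ring.ring_hom (mpoly_ring (R_vars n)) (Q_ring n)"
      using to_Q_ring_hom[of n] by (simp add: R_ring_def)
  next
    fix a b assume ab: "a < k" "b < k"
    then show "mat k k (\<lambda>(a, b). z_entry (\<iota> (Suc a)) (Suc b)) $$ (a, b) \<in> carrier (mpoly_ring (ZU_vars n))"
      using \<iota>[of "Suc a"] by (auto simp: z_entry_def intro: mpoly_ring_closed)
    show "mat k k (\<lambda>(a, b). H_mat n $$ (\<rho> a, b)) $$ (a, b) \<in> carrier (mpoly_ring (R_vars n))"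
      using H_mat_closed[of "\<rho> a" n b] \<rho>n ab assms(2) by (simp add: R_ring_def)
    interpret \<phi>: ring_hom_ring "ZU_ring n" "Q_ring n" \<phi>
      using assms(6) ring_Q_ring cring_mpoly_ring
      by (intro ring_hom_ringI2) (auto simp: cring_def ZU_ring_def)
    interpret \<psi>: ring_hom_ring "R_ring n" "Q_ring n" "to_Q n"
      using to_Q_ring_hom ring_Q_ring cring_mpoly_ring
      by (intro ring_hom_ringI2) (auto simp: cring_def R_ring_def)
    \<comment> \<open>These settle the entries above and on the diagonal of the unipotent matrix;
      those below it are given by the hypothesis on \<open>\<phi>\<close>.\<close>
    have "\<phi> 0 = to_Q n 0" "\<phi> 1 = to_Q n 1"
      using \<phi>.hom_zero \<psi>.hom_zero \<phi>.hom_one \<psi>.hom_one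
      by (simp_all add: ZU_ring_def R_ring_def mpoly_ring_simps)
    moreover have "H_poly 0 (Suc b) = 1"
      by (simp add: H_poly_def complete_sym_eq_hsym quantization_1)
    ultimately show "\<phi> (mat k k (\<lambda>(a, b). z_entry (\<iota> (Suc a)) (Suc b)) $$ (a, b)) =
        to_Q n (mat k k (\<lambda>(a, b). H_mat n $$ (\<rho> a, b)) $$ (a, b))"
      using ab \<rho>n[of a] assms(2) \<iota>[of "Suc a"] assms(7)[of "Suc b" "\<iota> (Suc a)"]
      by (auto simp: z_entry_def H_mat_def \<rho>_def)
  qed auto
qed

end
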